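(* Assume that $\mathcal{D}$ is an inclusion-closed collection and that the mean random dynamical system $\Phi$ on $L^p(\Omega,\mathcal{F};X)$ over $(\Omega,\mathcal{F},\{\mathcal{F}_t\}_{t\in\mathbb{R}},P)$ possesses an invariant weak $\mathcal{D}$-pullback mean random attractor $\mathcal{A}\in\mathcal{D}$ which is backwards bounded. Then for every $t\in\mathbb{R}$ $$\mathcal{A}(t)=\{\phi(t):\phi\in\mathcal{D}\text{ is a backwards bounded complete trajectory}\}.$$ If, moreover, $\mathcal{D}$ contains any backwards bounded family, then for every $t\in\mathbb{R}$ $$\mathcal{A}(t)=\{\phi(t):\phi\text{ is a backwards bounded complete trajectory}\}.$$
   Context: $X$ is a Banach space, $p\in(1,\infty)$, and $(\Omega,\mathcal{F},\{\mathcal{F}_t\}_{t\in\mathbb{R}},P)$ is a complete filtered probability space, $\{\mathcal{F}_t\}$ being an increasing right continuous family of sub-$\sigma$-algebras of $\mathcal{F}$ containing all $P$-null sets. $L^p(\Omega,\mathcal{F};X)$ is the Banach space of Bochner integrable $y:\Omega\to X$ with $\int_\Omega\|y\|_X^pdP<\infty$, and $L^p(\Omega,\mathcal{F}_t;X)$ its subspace of strongly $\mathcal{F}_t$-measurable elements. $\mathcal{D}$ is a given collection of families $D=\{D(t)\}_{t\in\mathbb{R}}$ of non-empty bounded sets $D(t)\subset L^p(\Omega,\mathcal{F}_t;X)$; it is inclusion-closed if $D\in\mathcal{D}$ and $\emptyset\ne B(t)\subset D(t)$ for all $t$ imply $\{B(t)\}_{t\in\mathbb{R}}\in\mathcal{D}$.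 A mean random dynamical system on $L^p(\Omega,\mathcal{F};X)$ over this filtered space is a family of maps $\Phi(t,\tau):L^p(\Omega,\mathcal{F}_\tau;X)\to L^p(\Omega,\mathcal{F}_{t+\tau};X)$, $t\ge0$, $\tau\in\mathbb{R}$, with $\Phi(0,\tau)=\mathrm{id}$ and $\Phi(t+s,\tau)=\Phi(t,s+\tau)\circ\Phi(s,\tau)$ for $t,s\ge0$. $K\in\mathcal{D}$ is $\mathcal{D}$-pullback weakly attracting if for all $\tau\in\mathbb{R}$, $D\in\mathcal{D}$ and any weak neighborhood $\mathcal{N}^w(K(\tau))$ of $K(\tau)$ in $L^p(\Omega,\mathcal{F}_\tau;X)$ there is $T>0$ with $\Phi(t,\tau-t)D(\tau-t)\subset\mathcal{N}^w(K(\tau))$ for all $t\ge T$. $\mathcal{A}\in\mathcal{D}$ is a weak $\mathcal{D}$-pullback mean random attractor if (1) $\mathcal{A}(\tau)$ is weakly compact in $L^p(\Omega,\mathcal{F}_\tau;X)$ for all $\tau$; (2) $\mathcal{A}$ is $\mathcal{D}$-pullback weakly attracting; (3) if $B\in\mathcal{D}$ satisfies (1) and (2), then $\mathcal{A}(t)\subset B(t)$ for all $t$. It is invariant if $\mathcal{A}(t)=\Phi(\tau,t-\tau)\mathcal{A}(t-\tau)$ for all $\tau\ge0$, $t\in\mathbb{R}$. A map $\phi$ with $\phi(t)\in L^p(\Omega,\mathcal{F}_t;X)$ for all $t\in\mathbb{R}$ is a complete trajectory if $\phi(t)=\Phi(t-s,s)\phi(s)$ for all $s<t$; it is identified with the family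 of singletons $\{\{\phi(t)\}\}_{t\in\mathbb{R}}$, and $\phi\in\mathcal{D}$ means that this family belongs to $\mathcal{D}$. A family $D=\{D(t)\}_{t\in\mathbb{R}}$ of non-empty bounded sets $D(t)\subset L^p(\Omega,\mathcal{F}_t;X)$ is backwards bounded if there is $t_0\in\mathbb{R}$ such that $\bigcup_{t\le t_0}D(t)$ is bounded. *)

theory Defs
  imports "HOL-Probability.Probability"
begin

section \<open>Complete filtered probability spaces\<close>

locale complete_filtered_prob_space =
  prob_space M + complete_measure M + filtration "space M" F
  for M :: "'w measure" and F :: "real \<Rightarrow> 'w measure" +
  assumes subalgebra_F: "\<And>t. subalgebra M (F t)"
    and right_continuous_F: "\<And>t. sets (F t) = (\<Inter>s\<in>{t<..}. sets (F s))"
    and null_sets_F: "\<And>t. null_sets M \<subseteq> sets (F t)"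

section \<open>Lebesgue--Bochner spaces\<close>

text \<open>
  The library's \<^const>\<open>integrable\<close> and \<^const>\<open>has_bochner_integral\<close> require the range to be
  second countable, i.e. separable. Since an arbitrary Banach space is needed, strong
  measurability and Bochner integrability are defined here by means of simple functions.
\<close>

definition strongly_measurable :: "'w measure \<Rightarrow> ('w \<Rightarrow> 'x::banach) \<Rightarrow> bool" where
  "strongly_measurable G y \<longleftrightarrow>
     (\<exists>s. (\<forall>i. simple_function G (s i)) \<and> (\<forall>\<omega>\<in>space G. (\<lambda>i. s i \<omega>) \<longlonglongrightarrow> y \<omega>))"

definition bochner_integrable :: "'w measure \<Rightarrow> ('w \<Rightarrow> 'x::banach) \<Rightarrow> bool" where
  "bochner_integrable M y \<longleftrightarrow>
     (\<exists>s. (\<forall>i. Bochner_Integration.simple_bochner_integrable M (s i)) \<and>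
          (AE \<omega> in M. (\<lambda>i. s i \<omega>) \<longlonglongrightarrow> y \<omega>) \<and>
          (\<lambda>i. \<integral>\<^sup>+\<omega>. ennreal (norm (y \<omega> - s i \<omega>)) \<partial>M) \<longlonglongrightarrow> 0)"

text \<open>Elements of the spaces are classes of functions modulo almost sure equality.\<close>

type_synonym ('w, 'x) rclass = "('w \<Rightarrow> 'x) set"

definition ae_class :: "'w measure \<Rightarrow> ('w \<Rightarrow> 'x::banach) \<Rightarrow> ('w, 'x) rclass" where
  "ae_class M y = {z. AE \<omega> in M. z \<omega> = y \<omega>}"

definition Lp :: "'w measure \<Rightarrow> real \<Rightarrow> ('w, 'x::banach) rclass set" where
  "Lp M p = {ae_class M y |y. bochner_integrable M y \<and>
                (\<integral>\<^sup>+\<omega>. ennreal (norm (y \<omega>) powr p) \<partial>M) < \<infinity>}"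

definition Lp_sub :: "'w measure \<Rightarrow> 'w measure \<Rightarrow> real \<Rightarrow> ('w, 'x::banach) rclass set" where
  "Lp_sub M G p = {u \<in> Lp M p. \<exists>y\<in>u. strongly_measurable G y}"

definition rep :: "('w, 'x::banach) rclass \<Rightarrow> 'w \<Rightarrow> 'x" where
  "rep u = (SOME y. y \<in> u)"

definition Lp_add ::
  "'w measure \<Rightarrow> ('w, 'x::banach) rclass \<Rightarrow> ('w, 'x) rclass \<Rightarrow> ('w, 'x) rclass" where
  "Lp_add M u v = ae_class M (\<lambda>\<omega>. rep u \<omega> + rep v \<omega>)"

definition Lp_scale ::
  "'w measure \<Rightarrow> real \<Rightarrow> ('w, 'x::banach) rclass \<Rightarrow> ('w, 'x) rclass" where
  "Lp_scale M c u = ae_class M (\<lambda>\<omega>. c *\<^sub>R rep u \<omega>)"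

definition Lp_norm :: "'w measure \<Rightarrow> real \<Rightarrow> ('w, 'x::banach) rclass \<Rightarrow> real" where
  "Lp_norm M p u = (\<integral>\<omega>. norm (rep u \<omega>) powr p \<partial>M) powr (1 / p)"

definition Lp_bounded :: "'w measure \<Rightarrow> real \<Rightarrow> ('w, 'x::banach) rclass set \<Rightarrow> bool" where
  "Lp_bounded M p S \<longleftrightarrow> S \<subseteq> Lp M p \<and> (\<exists>C. \<forall>u\<in>S. Lp_norm M p u \<le> C)"

section \<open>Weak topology\<close>

text \<open>
  Real functionals suffice also when the range is a complex Banach space: real and complex
  bounded functionals induce the same weak topology.
\<close>

definition Lp_dual ::
  "'w measure \<Rightarrow> 'w measure \<Rightarrow> real \<Rightarrow> (('w, 'x::banach) rclass \<Rightarrow> real) set" where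
  "Lp_dual M G p = {l.
     (\<forall>u\<in>Lp_sub M G p. \<forall>v\<in>Lp_sub M G p. l (Lp_add M u v) = l u + l v) \<and>
     (\<forall>c. \<forall>u\<in>Lp_sub M G p. l (Lp_scale M c u) = c * l u) \<and>
     (\<exists>C. \<forall>u\<in>Lp_sub M G p. \<bar>l u\<bar> \<le> C * Lp_norm M p u)}"

definition Lp_weak ::
  "'w measure \<Rightarrow> 'w measure \<Rightarrow> real \<Rightarrow> ('w, 'x::banach) rclass topology" where
  "Lp_weak M G p =
     topology_generated_by {{u \<in> Lp_sub M G p. l u \<in> V} |l V. l \<in> Lp_dual M G p \<and> open V}"

definition weak_neighborhood ::
  "'w measure \<Rightarrow> 'w measure \<Rightarrow> real \<Rightarrow> ('w, 'x::banach) rclass set \<Rightarrow>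
     ('w, 'x) rclass set \<Rightarrow> bool" where
  "weak_neighborhood M G p K N \<longleftrightarrow>
     N \<subseteq> Lp_sub M G p \<and> (\<exists>U. openin (Lp_weak M G p) U \<and> K \<subseteq> U \<and> U \<subseteq> N)"

section \<open>Families of bounded sets\<close>

type_synonym ('w, 'x) family = "real \<Rightarrow> ('w, 'x) rclass set"

definition bounded_family ::
  "'w measure \<Rightarrow> (real \<Rightarrow> 'w measure) \<Rightarrow> real \<Rightarrow> ('w, 'x::banach) family \<Rightarrow> bool" where
  "bounded_family M F p D \<longleftrightarrow>
     (\<forall>t. D t \<noteq> {} \<and> D t \<subseteq> Lp_sub M (F t) p \<and> Lp_bounded M p (D t))"

definition backwards_bounded ::
  "'w measure \<Rightarrow> (real \<Rightarrow> 'w measure) \<Rightarrow> real \<Rightarrow> ('w, 'x::banach) family \<Rightarrow> bool" where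
  "backwards_bounded M F p D \<longleftrightarrow>
     bounded_family M F p D \<and> (\<exists>t0. Lp_bounded M p (\<Union>t\<in>{..t0}. D t))"

definition inclusion_closed :: "('w, 'x::banach) family set \<Rightarrow> bool" where
  "inclusion_closed \<D> \<longleftrightarrow>
     (\<forall>D\<in>\<D>. \<forall>B. (\<forall>t. B t \<noteq> {} \<and> B t \<subseteq> D t) \<longrightarrow> B \<in> \<D>)"

section \<open>Mean random dynamical systems\<close>

type_synonym ('w, 'x) cocycle = "real \<Rightarrow> real \<Rightarrow> ('w, 'x) rclass \<Rightarrow> ('w, 'x) rclass"

definition mean_rds ::
  "'w measure \<Rightarrow> (real \<Rightarrow> 'w measure) \<Rightarrow> real \<Rightarrow> ('w, 'x::banach) cocycle \<Rightarrow> bool" where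
  "mean_rds M F p \<Phi> \<longleftrightarrow>
     (\<forall>t\<ge>0. \<forall>\<tau>. \<Phi> t \<tau> ` Lp_sub M (F \<tau>) p \<subseteq> Lp_sub M (F (t + \<tau>)) p) \<and>
     (\<forall>\<tau>. \<forall>u\<in>Lp_sub M (F \<tau>) p. \<Phi> 0 \<tau> u = u) \<and>
     (\<forall>t\<ge>0. \<forall>s\<ge>0. \<forall>\<tau>. \<forall>u\<in>Lp_sub M (F \<tau>) p.
        \<Phi> (t + s) \<tau> u = \<Phi> t (s + \<tau>) (\<Phi> s \<tau> u))"

definition weakly_attracting ::
  "'w measure \<Rightarrow> (real \<Rightarrow> 'w measure) \<Rightarrow> real \<Rightarrow> ('w, 'x::banach) cocycle \<Rightarrow>
     ('w, 'x) family set \<Rightarrow> ('w, 'x) family \<Rightarrow> bool" where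
  "weakly_attracting M F p \<Phi> \<D> K \<longleftrightarrow> K \<in> \<D> \<and>
     (\<forall>\<tau>. \<forall>D\<in>\<D>. \<forall>N. weak_neighborhood M (F \<tau>) p (K \<tau>) N \<longrightarrow>
        (\<exists>T>0. \<forall>t\<ge>T. \<Phi> t (\<tau> - t) ` D (\<tau> - t) \<subseteq> N))"

definition weakly_compact_family ::
  "'w measure \<Rightarrow> (real \<Rightarrow> 'w measure) \<Rightarrow> real \<Rightarrow> ('w, 'x::banach) family \<Rightarrow> bool" where
  "weakly_compact_family M F p K \<longleftrightarrow> (\<forall>\<tau>. compactin (Lp_weak M (F \<tau>) p) (K \<tau>))"

definition weak_attractor ::
  "'w measure \<Rightarrow> (real \<Rightarrow> 'w measure) \<Rightarrow> real \<Rightarrow> ('w, 'x::banach) cocycle \<Rightarrow>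
     ('w, 'x) family set \<Rightarrow> ('w, 'x) family \<Rightarrow> bool" where
  "weak_attractor M F p \<Phi> \<D> A \<longleftrightarrow> A \<in> \<D> \<and>
     weakly_compact_family M F p A \<and> weakly_attracting M F p \<Phi> \<D> A \<and>
     (\<forall>B\<in>\<D>. weakly_compact_family M F p B \<and> weakly_attracting M F p \<Phi> \<D> B \<longrightarrow>
        (\<forall>t. A t \<subseteq> B t))"

definition invariant :: "('w, 'x::banach) cocycle \<Rightarrow> ('w, 'x) family \<Rightarrow> bool" where
  "invariant \<Phi> A \<longleftrightarrow> (\<forall>\<tau>\<ge>0. \<forall>t. A t = \<Phi> \<tau> (t - \<tau>) ` A (t - \<tau>))"

definition complete_trajectory ::
  "'w measure \<Rightarrow> (real \<Rightarrow> 'w measure) \<Rightarrow> real \<Rightarrow> ('w, 'x::banach) cocycle \<Rightarrow>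
     (real \<Rightarrow> ('w, 'x) rclass) \<Rightarrow> bool" where
  "complete_trajectory M F p \<Phi> \<phi> \<longleftrightarrow>
     (\<forall>t. \<phi> t \<in> Lp_sub M (F t) p) \<and> (\<forall>s t. s < t \<longrightarrow> \<phi> t = \<Phi> (t - s) s (\<phi> s))"

definition singletons :: "(real \<Rightarrow> ('w, 'x::banach) rclass) \<Rightarrow> ('w, 'x) family" where
  "singletons \<phi> = (\<lambda>t. {\<phi> t})"

end

theory Submission
  imports Defs
begin

text \<open>
  Every point of \<open>A t\<close> lies on a complete trajectory inside \<open>A\<close>: invariance gives successive
  preimages at the times \<open>t - n\<close>, and \<open>\<Phi>\<close> interpolates between them. Such a trajectory inherits
  backwards boundedness and membership in \<open>\<D>\<close> from \<open>A\<close>.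

  Conversely, a complete trajectory \<open>\<phi>\<close> in \<open>\<D>\<close> is attracted by \<open>A\<close>, but is also its own pullback image, so
  \<open>\<phi> t\<close> lies in every weak neighbourhood of \<open>A t\<close>. Since the weak topology is \<open>T\<^sub>1\<close>, the
  complement of \<open>{\<phi> t}\<close> would be such a neighbourhood if \<open>\<phi> t\<close> were not in \<open>A t\<close>. The \<open>T\<^sub>1\<close>
  property needs enough functionals on the Bochner space; these are integrals of \<open>g * (f \<circ> u)\<close>
  with \<open>g\<close> bounded measurable and \<open>f\<close> in the dual of the range, by Hahn--Banach.
\<close>

section \<open>Hahn--Banach by minimal sublinear functionals\<close>

text \<open>Asking for homogeneity only as an inequality with positive scalars keeps infima easy to
  check; applying it to \<open>1/c\<close> as well recovers equality in
  \<open>sublinear_scale\<close>.\<close>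

definition sublinear :: "('x::real_vector \<Rightarrow> real) \<Rightarrow> bool" where
  "sublinear q \<longleftrightarrow> (\<forall>x y. q (x + y) \<le> q x + q y) \<and> (\<forall>c>0. \<forall>x. q (c *\<^sub>R x) \<le> c * q x)"

lemma sublinear_add: "sublinear q \<Longrightarrow> q (x + y) \<le> q x + q y"
  by (simp add: sublinear_def)

lemma sublinear_zero: "sublinear q \<Longrightarrow> q 0 = 0"
proof -
  assume "sublinear q"
  then have "q (2 *\<^sub>R 0) \<le> 2 * q 0" "q ((1/2) *\<^sub>R 0) \<le> (1/2) * q 0"
    unfolding sublinear_def by (meson zero_less_numeral half_gt_zero zero_less_one)+
  then show ?thesis by simp
qed

lemma sublinear_scale:
  assumes "sublinear q" "c \<ge> 0" shows "q (c *\<^sub>R x) = c * q x"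
proof (cases "c = 0")
  case True
  then show ?thesis using sublinear_zero[OF assms(1)] by simp
next
  case False
  with assms have c: "c > 0" by simp
  have "q ((1/c) *\<^sub>R (c *\<^sub>R x)) \<le> (1/c) * q (c *\<^sub>R x)"
    using assms(1) c unfolding sublinear_def by (meson zero_less_divide_1_iff)
  then have "c * q x \<le> q (c *\<^sub>R x)"
    using c by (simp add: field_simps)
  moreover have "q (c *\<^sub>R x) \<le> c * q x"
    using assms(1) c unfolding sublinear_def by blast
  ultimately show ?thesis by simp
qed

lemma sublinear_minus: "sublinear q \<Longrightarrow> - q (- x) \<le> q x"
  using sublinear_add[of q x "- x"] sublinear_zero[of q] by simp

text \<open>Take the infimum of \<open>q (x + t *\<^sub>R a) - t * q a\<close> over
  \<open>t \<ge> 0\<close>; the choices \<open>t = 0\<close> and \<open>t = 1\<close> give the two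
  bounds. This lowers \<open>q\<close> towards additivity along \<open>a\<close>.\<close>

lemma sublinear_shift:
  assumes q: "sublinear q"
  obtains q' where "sublinear q'" "\<And>x. q' x \<le> q x" "\<And>x. q' x \<le> q (x + a) - q a"
proof
  define S where "S x = (\<lambda>t. q (x + t *\<^sub>R a) - t * q a) ` {0..}" for x
  define q' where "q' x = Inf (S x)" for x
  \<comment> \<open>The bound does not depend on \<open>t\<close>, so the infimum is a genuine
    one.\<close>
  have lb: "- q (- x) \<le> q (x + t *\<^sub>R a) - t * q a" if "t \<ge> 0" for x t
    using sublinear_add[OF q, of "x + t *\<^sub>R a" "- x"] sublinear_scale[OF q that, of a] by simp
  have bdd: "bdd_below (S x)" for x
    unfolding S_def bdd_below_def using lb by fastforce
  have ne: "S x \<noteq> {}" for x unfolding S_def by auto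
  have le: "q' x \<le> q (x + t *\<^sub>R a) - t * q a" if "t \<ge> 0" for x t
    unfolding q'_def using bdd that by (intro cInf_lower) (auto simp: S_def)
  have ge: "b \<le> q' x" if "\<And>t. t \<ge> 0 \<Longrightarrow> b \<le> q (x + t *\<^sub>R a) - t * q a" for b x
    unfolding q'_def using that ne by (intro cInf_greatest) (auto simp: S_def)
  show "q' x \<le> q x" for x using le[of 0 x] by simp
  show "q' x \<le> q (x + a) - q a" for x using le[of 1 x] by simp
  have "q' (x + y) \<le> q' x + q' y" for x y
  proof -
    \<comment> \<open>With \<open>s\<close> admissible for \<open>x\<close> and \<open>t\<close> for
      \<open>y\<close>, the sum \<open>s + t\<close> is admissible for \<open>x + y\<close>.\<close>
    have "q' (x + y) - (q (x + s *\<^sub>R a) - s * q a) \<le> q' y" if s: "s \<ge> 0" for s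
    proof (rule ge)
      fix t :: real assume t: "t \<ge> 0"
      have "q' (x + y) \<le> q (x + y + (s + t) *\<^sub>R a) - (s + t) * q a"
        using s t by (intro le) auto
      also have "x + y + (s + t) *\<^sub>R a = (x + s *\<^sub>R a) + (y + t *\<^sub>R a)"
        by (simp add: algebra_simps)
      finally show "q' (x + y) - (q (x + s *\<^sub>R a) - s * q a) \<le> q (y + t *\<^sub>R a) - t * q a"
        using sublinear_add[OF q, of "x + s *\<^sub>R a" "y + t *\<^sub>R a"] by (simp add: algebra_simps)
    qed
    then have "q' (x + y) - q' y \<le> q' x"
      by (intro ge) (simp add: algebra_simps)
    then show ?thesis by simp
  qed
  moreover have "q' (c *\<^sub>R x) \<le> c * q' x" if c: "c > 0" for c x
  proof -
    have "q' (c *\<^sub>R x) / c \<le> q' x"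
    proof (rule ge)
      fix t :: real assume t: "t \<ge> 0"
      have "q' (c *\<^sub>R x) \<le> q (c *\<^sub>R x + (c * t) *\<^sub>R a) - (c * t) * q a"
        using c t by (intro le) auto
      also have "c *\<^sub>R x + (c * t) *\<^sub>R a = c *\<^sub>R (x + t *\<^sub>R a)"
        by (simp add: algebra_simps)
      finally show "q' (c *\<^sub>R x) / c \<le> q (x + t *\<^sub>R a) - t * q a"
        using c sublinear_scale[OF q, of c "x + t *\<^sub>R a"] by (simp add: field_simps)
    qed
    then show ?thesis using c by (simp add: field_simps)
  qed
  ultimately show "sublinear q'" unfolding sublinear_def by blast
qed

text \<open>The pointwise infimum works. Subadditivity relies on the chain: competitors
  \<open>q\<close> at \<open>x\<close> and \<open>r\<close> at \<open>y\<close> are comparable, so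
  the smaller one serves at both points.\<close>

lemma sublinear_Inf_chain:
  assumes ne: "C \<noteq> {}" and sub: "\<And>q. q \<in> C \<Longrightarrow> sublinear q"
    and chain: "\<And>q r. q \<in> C \<Longrightarrow> r \<in> C \<Longrightarrow> q \<le> r \<or> r \<le> q"
  obtains u where "sublinear u" "\<And>q. q \<in> C \<Longrightarrow> u \<le> q"
proof
  define u where "u x = Inf ((\<lambda>q. q x) ` C)" for x
  obtain q0 where q0: "q0 \<in> C" using ne by blast
  \<comment> \<open>One fixed member bounds all others from below: either \<open>q\<close> lies
    below \<open>q0\<close> at \<open>- x\<close>, and \<open>- q (- x) \<le> q x\<close> applies,
    or \<open>q0\<close> lies below \<open>q\<close> at \<open>x\<close>.\<close>
  have "- q0 (- x) \<le> q x" if q: "q \<in> C" for q x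
  proof -
    have "q (- x) \<le> q0 (- x) \<or> q0 x \<le> q x"
      using chain[OF q q0] by (auto simp: le_fun_def)
    then show ?thesis
      using sublinear_minus[OF sub[OF q], of x] sublinear_minus[OF sub[OF q0], of x] by auto
  qed
  then have bdd: "bdd_below ((\<lambda>q. q x) ` C)" for x
    unfolding bdd_below_def by blast
  have le: "u x \<le> q x" if "q \<in> C" for q x
    unfolding u_def using bdd that by (intro cInf_lower) auto
  have ge: "b \<le> u x" if "\<And>q. q \<in> C \<Longrightarrow> b \<le> q x" for b x
    unfolding u_def using that ne by (intro cInf_greatest) auto
  show "u \<le> q" if "q \<in> C" for q using le that by (simp add: le_fun_def)
  have "u (x + y) \<le> u x + u y" for x y
  proof -
    have "u (x + y) - q x \<le> u y" if q: "q \<in> C" for q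
    proof (rule ge)
      fix r assume r: "r \<in> C"
      have "u (x + y) \<le> q x + q y" "u (x + y) \<le> r x + r y"
        using le[OF q, of "x + y"] le[OF r, of "x + y"]
          sublinear_add[OF sub[OF q], of x y] sublinear_add[OF sub[OF r], of x y] by auto
      moreover have "q y \<le> r y \<or> r x \<le> q x"
        using chain[OF q r] by (auto simp: le_fun_def)
      ultimately show "u (x + y) - q x \<le> r y" by auto
    qed
    then have "u (x + y) - u y \<le> u x"
      by (intro ge) (simp add: algebra_simps)
    then show ?thesis by simp
  qed
  moreover have "u (c *\<^sub>R x) \<le> c * u x" if c: "c > 0" for c x
  proof -
    have "u (c *\<^sub>R x) / c \<le> u x"
    proof (rule ge)
      fix q assume q: "q \<in> C"
      show "u (c *\<^sub>R x) / c \<le> q x"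
        using le[OF q, of "c *\<^sub>R x"] sublinear_scale[OF sub[OF q], of c x] c
        by (simp add: field_simps)
    qed
    then show ?thesis using c by (simp add: field_simps)
  qed
  ultimately show "sublinear u" unfolding sublinear_def by blast
qed

text \<open>A minimal sublinear functional is additive: by minimality the functional produced by
  \<open>sublinear_shift\<close> cannot be smaller, which yields superadditivity.\<close>

lemma sublinear_dominates_linear:
  fixes q :: "'x::real_vector \<Rightarrow> real"
  assumes q: "sublinear q"
  obtains f where "linear f" "\<And>x. f x \<le> q x"
proof -
  let ?A = "{r. sublinear r \<and> r \<le> q}"
  \<comment> \<open>Zorn's lemma is applied to the reversed order, so its maximal element is a
    minimal sublinear functional below \<open>q\<close>.\<close>
  have "\<exists>m\<in>?A. \<forall>r\<in>?A. r \<le> m \<longrightarrow> r = m"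
  proof (rule predicate_Zorn)
    show "partial_order_on ?A (relation_of (\<lambda>p r. r \<le> p) ?A)"
      by (rule partial_order_on_relation_ofI) auto
    fix C assume C: "C \<in> Chains (relation_of (\<lambda>p r. r \<le> p) ?A)"
    then have CA: "C \<subseteq> ?A" unfolding Chains_def relation_of_def by blast
    have chain: "r \<le> s \<or> s \<le> r" if "r \<in> C" "s \<in> C" for r s
      using C that unfolding Chains_def relation_of_def by blast
    show "\<exists>u\<in>?A. \<forall>a\<in>C. u \<le> a"
    proof (cases "C = {}")
      case True
      with q show ?thesis by auto
    next
      case False
      obtain u where u: "sublinear u" "\<And>r. r \<in> C \<Longrightarrow> u \<le> r"
        using sublinear_Inf_chain[OF False _ chain] CA by blast
      moreover obtain r where "r \<in> C" using False by blast
      ultimately show ?thesis using CA order_trans by blast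
    qed
  qed
  then obtain m where m: "sublinear m" "m \<le> q"
    and min: "\<And>r. sublinear r \<Longrightarrow> r \<le> q \<Longrightarrow> r \<le> m \<Longrightarrow> r = m" by blast
  have add: "m (x + a) = m x + m a" for x a
  proof -
    obtain m' where m': "sublinear m'" "\<And>x. m' x \<le> m x" "\<And>x. m' x \<le> m (x + a) - m a"
      using sublinear_shift[OF m(1)] by metis
    then have "m' \<le> m" by (simp add: le_fun_def)
    with min[OF m'(1)] m(2) have "m' = m" by (meson order_trans)
    with m'(3)[of x] sublinear_add[OF m(1), of x a] show ?thesis by simp
  qed
  have neg: "m (- x) = - m x" for x
    using add[of x "- x"] sublinear_zero[OF m(1)] by simp
  have "m (c *\<^sub>R x) = c * m x" for c x
  proof (cases "c \<ge> 0")
    case True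
    then show ?thesis by (rule sublinear_scale[OF m(1)])
  next
    case False
    then have "m ((- c) *\<^sub>R x) = (- c) * m x" by (intro sublinear_scale[OF m(1)]) simp
    then show ?thesis using neg[of "c *\<^sub>R x"] by simp
  qed
  with add have "linear m" by (intro linearI) auto
  with m(2) show ?thesis by (intro that) (auto simp: le_fun_def)
qed

text \<open>Shifting the norm along \<open>x\<close> gives a sublinear \<open>q\<close> with
  \<open>q (- x) \<le> - norm x\<close>. A linear \<open>f\<close> below \<open>q\<close> then
  satisfies \<open>f x \<ge> norm x\<close>.\<close>

lemma norming_functional:
  fixes x :: "'x::real_normed_vector"
  obtains f :: "'x \<Rightarrow> real" where "linear f" "f x = norm x" "\<And>y. \<bar>f y\<bar> \<le> norm y"
proof -
  have "sublinear (norm :: 'x \<Rightarrow> real)"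
    unfolding sublinear_def by (auto intro: norm_triangle_ineq)
  then obtain q :: "'x \<Rightarrow> real" where q: "sublinear q" "\<And>y. q y \<le> norm y"
      "\<And>y. q y \<le> norm (y + x) - norm x"
    using sublinear_shift[where a = x] by metis
  obtain f where f: "linear f" "\<And>y. f y \<le> q y"
    using sublinear_dominates_linear[OF q(1)] by metis
  have le: "f y \<le> norm y" for y using f(2) q(2) order_trans by blast
  have neg: "f (- y) = - f y" for y using f(1) by (simp add: linear_neg)
  have "f (- x) \<le> - norm x" using f(2)[of "- x"] q(3)[of "- x"] by simp
  then have "f x = norm x" using le[of x] neg[of x] by simp
  moreover have "\<bar>f y\<bar> \<le> norm y" for y using le[of y] le[of "- y"] neg[of y] by simp
  ultimately show ?thesis using that f(1) by blast
qed

section \<open>Measurability modulo null sets and strong measurability\<close>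

text \<open>Preimages under \<open>f\<close> and \<open>g\<close> differ inside a null set, which
  completeness makes measurable. This handles \<open>rep\<close>, an arbitrary member of an almost
  sure class.\<close>

lemma (in complete_measure) borel_measurable_AE_eq:
  fixes f g :: "'a \<Rightarrow> 'b::topological_space"
  assumes f: "f \<in> borel_measurable M" and eq: "AE x in M. f x = g x"
  shows "g \<in> borel_measurable M"
proof (rule measurableI)
  fix S :: "'b set" assume S: "S \<in> sets borel"
  show "g -` S \<inter> space M \<in> sets M"
  proof (rule in_sets_AE)
    show "AE x in M. x \<in> f -` S \<inter> space M \<longleftrightarrow> x \<in> g -` S \<inter> space M"
      using eq by eventually_elim auto
    show "f -` S \<inter> space M \<in> sets M" using f S by (rule measurable_sets)
  qed simp
qed simp

text \<open>Passes from vector-valued to real-valued functions: \<open>h\<close> keeps simple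
  functions simple and preserves their limits.\<close>

lemma strongly_measurable_continuous_comp:
  fixes h :: "'x::banach \<Rightarrow> real"
  assumes "strongly_measurable G y" and h: "continuous_on UNIV h"
  shows "(\<lambda>\<omega>. h (y \<omega>)) \<in> borel_measurable G"
proof -
  obtain s where s: "\<And>i. simple_function G (s i)"
      and lim: "\<And>\<omega>. \<omega> \<in> space G \<Longrightarrow> (\<lambda>i. s i \<omega>) \<longlonglongrightarrow> y \<omega>"
    using assms(1) unfolding strongly_measurable_def by blast
  show ?thesis
  proof (rule borel_measurable_LIMSEQ_metric)
    show "(\<lambda>\<omega>. h (s i \<omega>)) \<in> borel_measurable G" for i
      using simple_function_compose1[OF s] by (rule borel_measurable_simple_function)
    show "(\<lambda>i. h (s i \<omega>)) \<longlonglongrightarrow> h (y \<omega>)" if "\<omega> \<in> space G" for \<omega>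
      using lim[OF that] h by (auto intro: continuous_on_tendsto_compose)
  qed
qed

lemma strongly_measurable_subalgebra:
  "subalgebra M G \<Longrightarrow> strongly_measurable G y \<Longrightarrow> strongly_measurable M y"
  unfolding strongly_measurable_def simple_function_def subalgebra_def by (metis in_mono)

lemma strongly_measurable_diff:
  assumes "strongly_measurable G y" "strongly_measurable G z"
  shows "strongly_measurable G (\<lambda>\<omega>. y \<omega> - z \<omega>)"
proof -
  obtain s t where "\<And>i. simple_function G (s i)" "\<And>i. simple_function G (t i)"
      "\<And>\<omega>. \<omega> \<in> space G \<Longrightarrow> (\<lambda>i. s i \<omega>) \<longlonglongrightarrow> y \<omega>"
      "\<And>\<omega>. \<omega> \<in> space G \<Longrightarrow> (\<lambda>i. t i \<omega>) \<longlonglongrightarrow> z \<omega>"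
    using assms unfolding strongly_measurable_def by blast
  then show ?thesis
    unfolding strongly_measurable_def
    by (intro exI[of _ "\<lambda>i \<omega>. s i \<omega> - t i \<omega>"]) (auto intro!: tendsto_diff simple_function_diff)
qed

text \<open>The simple functions approximating \<open>y\<close> take only countably many values, so that
  countably many norming functionals suffice.\<close>

lemma strongly_measurable_eq_0_AE:
  fixes y :: "'w \<Rightarrow> 'x::banach"
  assumes y: "strongly_measurable M y"
    and zero: "\<And>f :: 'x \<Rightarrow> real. linear f \<Longrightarrow> (\<And>x. \<bar>f x\<bar> \<le> norm x) \<Longrightarrow> AE \<omega> in M. f (y \<omega>) = 0"
  shows "AE \<omega> in M. y \<omega> = 0"
proof -
  obtain s where s: "\<And>i. simple_function M (s i)"
      and lim: "\<And>\<omega>. \<omega> \<in> space M \<Longrightarrow> (\<lambda>i. s i \<omega>) \<longlonglongrightarrow> y \<omega>"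
    using y unfolding strongly_measurable_def by blast
  define C where "C = (\<Union>i. s i ` space M)"
  have C: "countable C"
    unfolding C_def using s by (auto simp: simple_function_def intro: countable_finite)
  have "\<exists>f :: 'x \<Rightarrow> real. linear f \<and> f c = norm c \<and> (\<forall>x. \<bar>f x\<bar> \<le> norm x)" for c
    by (metis norming_functional)
  then obtain f :: "'x \<Rightarrow> 'x \<Rightarrow> real" where f: "\<And>c. linear (f c)" "\<And>c. f c c = norm c"
      "\<And>c x. \<bar>f c x\<bar> \<le> norm x" by metis
  have "AE \<omega> in M. \<forall>c\<in>C. f c (y \<omega>) = 0"
    using C by (subst AE_ball_countable) (auto intro: zero f)
  then show ?thesis
  proof (rule AE_mp, intro AE_I2 impI)
    fix \<omega> assume \<omega>: "\<omega> \<in> space M" and 0: "\<forall>c\<in>C. f c (y \<omega>) = 0"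
    \<comment> \<open>The functional norming \<open>s i \<omega>\<close> kills
      \<open>y \<omega>\<close>, so it has the same value at
      \<open>s i \<omega> - y \<omega>\<close>, whose norm tends to 0.\<close>
    have "norm (s i \<omega>) \<le> norm (s i \<omega> - y \<omega>)" for i
    proof -
      have "s i \<omega> \<in> C" using \<omega> unfolding C_def by blast
      then have "norm (s i \<omega>) = f (s i \<omega>) (s i \<omega> - y \<omega>)"
        using 0 f by (simp add: linear_diff)
      then show ?thesis using f(3)[of "s i \<omega>" "s i \<omega> - y \<omega>"] by simp
    qed
    moreover have "(\<lambda>i. norm (s i \<omega> - y \<omega>)) \<longlonglongrightarrow> norm (y \<omega> - y \<omega>)"
      by (intro tendsto_intros lim \<omega>)
    moreover have "(\<lambda>i. norm (s i \<omega>)) \<longlonglongrightarrow> norm (y \<omega>)"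
      by (intro tendsto_intros lim \<omega>)
    ultimately have "norm (y \<omega>) \<le> norm (y \<omega> - y \<omega>)"
      by (intro LIMSEQ_le) auto
    then show "y \<omega> = 0" by simp
  qed
qed

section \<open>Almost sure classes and their representatives\<close>

lemma rep_ae_class: "AE \<omega> in M. rep (ae_class M y) \<omega> = y \<omega>"
proof -
  have "y \<in> ae_class M y" by (simp add: ae_class_def)
  then have "rep (ae_class M y) \<in> ae_class M y"
    unfolding rep_def by (metis someI)
  then show ?thesis by (simp add: ae_class_def)
qed

lemma ae_class_cong: "AE \<omega> in M. y \<omega> = z \<omega> \<Longrightarrow> ae_class M y = ae_class M z"
  unfolding ae_class_def by (auto elim!: AE_mp)

lemma Lp_sub_strongly_measurable_rep:
  assumes u: "u \<in> Lp_sub M G p" and G: "subalgebra M G"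
  obtains y where "strongly_measurable M y" "AE \<omega> in M. rep u \<omega> = y \<omega>"
    "u = ae_class M y" "(\<integral>\<^sup>+\<omega>. ennreal (norm (y \<omega>) powr p) \<partial>M) < \<infinity>"
proof -
  obtain y z where y: "y \<in> u" "strongly_measurable G y" and z: "u = ae_class M z"
      and fin: "(\<integral>\<^sup>+\<omega>. ennreal (norm (z \<omega>) powr p) \<partial>M) < \<infinity>"
    using u unfolding Lp_sub_def Lp_def by blast
  \<comment> \<open>The strongly measurable member \<open>y\<close> and the member \<open>z\<close>
    with finite p-th moment may be different functions of the same class.\<close>
  have eq: "AE \<omega> in M. y \<omega> = z \<omega>" using y(1) z by (simp add: ae_class_def)
  then have "(\<integral>\<^sup>+\<omega>. ennreal (norm (y \<omega>) powr p) \<partial>M) = (\<integral>\<^sup>+\<omega>. ennreal (norm (z \<omega>) powr p) \<partial>M)"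
    by (intro nn_integral_cong_AE) auto
  moreover have "u = ae_class M y" using ae_class_cong[OF eq] z by simp
  ultimately show ?thesis
    using that[of y] rep_ae_class[of M y] strongly_measurable_subalgebra[OF G y(2)] fin by simp
qed

section \<open>Integral functionals and separation in the weak topology\<close>

text \<open>For \<open>a > N\<close> use \<open>a / N \<le> (a / N) powr p\<close>. Integrated with
  \<open>N\<close> the L^p norm, this replaces Hoelder's inequality at the cost of a factor
  2.\<close>

lemma le_add_powr:
  fixes a N p :: real
  assumes "0 \<le> a" "0 < N" "1 \<le> p"
  shows "a \<le> N + N powr (1 - p) * a powr p"
proof (cases "a \<le> N")
  case True
  then show ?thesis using assms by (simp add: add_increasing2)
next
  case False
  then have a: "0 < a" "1 \<le> a / N" using assms by auto
  have "a = N * (a / N) powr 1" using a assms by simp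
  also have "\<dots> \<le> N * (a / N) powr p"
    using a assms by (intro mult_left_mono powr_mono) auto
  also have "\<dots> = N powr (1 - p) * a powr p"
    using a assms by (simp add: powr_divide powr_diff)
  finally show ?thesis using assms by simp
qed

context
  fixes M G :: "'w measure" and p :: real
  assumes M: "prob_space M" "complete_measure M" and G: "subalgebra M G" and p: "1 < p"
begin

interpretation prob_space M by (fact M)
interpretation complete_measure M by (fact M)

text \<open>Measurability is with respect to \<open>M\<close>, not \<open>G\<close>:
  \<open>rep u\<close> agrees only almost surely with a strongly measurable member.\<close>

lemma Lp_sub_continuous_measurable:
  fixes h :: "'x::banach \<Rightarrow> real"
  assumes u: "u \<in> Lp_sub M G p" and h: "continuous_on UNIV h"
  shows "(\<lambda>\<omega>. h (rep u \<omega>)) \<in> borel_measurable M"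
proof -
  obtain y where y: "strongly_measurable M y" "AE \<omega> in M. rep u \<omega> = y \<omega>"
    using Lp_sub_strongly_measurable_rep[OF u G] by metis
  show ?thesis
    using strongly_measurable_continuous_comp[OF y(1) h]
    by (rule borel_measurable_AE_eq) (use y(2) in eventually_elim, simp)
qed

lemma Lp_sub_integrable_powr:
  fixes u :: "('w, 'x::banach) rclass"
  assumes u: "u \<in> Lp_sub M G p"
  shows "integrable M (\<lambda>\<omega>. norm (rep u \<omega>) powr p)"
proof -
  obtain y where y: "strongly_measurable M y" "AE \<omega> in M. rep u \<omega> = y \<omega>"
      "(\<integral>\<^sup>+\<omega>. ennreal (norm (y \<omega>) powr p) \<partial>M) < \<infinity>"
    using Lp_sub_strongly_measurable_rep[OF u G] by metis
  have [measurable]: "(\<lambda>\<omega>. norm (rep u \<omega>)) \<in> borel_measurable M"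
    using u by (intro Lp_sub_continuous_measurable continuous_intros)
  have "(\<integral>\<^sup>+\<omega>. ennreal (norm (rep u \<omega>) powr p) \<partial>M) = (\<integral>\<^sup>+\<omega>. ennreal (norm (y \<omega>) powr p) \<partial>M)"
    using y(2) by (intro nn_integral_cong_AE) auto
  with y(3) show ?thesis
    by (intro integrableI_bounded) auto
qed

lemma Lp_sub_integrable_norm:
  fixes u :: "('w, 'x::banach) rclass"
  assumes u: "u \<in> Lp_sub M G p"
  shows "integrable M (\<lambda>\<omega>. norm (rep u \<omega>))"
proof (rule Bochner_Integration.integrable_bound)
  \<comment> \<open>The dominating function is \<open>le_add_powr\<close> with \<open>N = 1\<close>;
    constants are integrable on a probability space.\<close>
  show "integrable M (\<lambda>\<omega>. 1 + norm (rep u \<omega>) powr p)"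
    using Lp_sub_integrable_powr[OF u] by simp
  show "(\<lambda>\<omega>. norm (rep u \<omega>)) \<in> borel_measurable M"
    using u by (intro Lp_sub_continuous_measurable continuous_intros)
  show "AE \<omega> in M. norm (norm (rep u \<omega>)) \<le> norm (1 + norm (rep u \<omega>) powr p)"
    using le_add_powr[of _ 1 p] p by (intro AE_I2) simp
qed

lemma integral_norm_le_Lp_norm:
  fixes u :: "('w, 'x::banach) rclass"
  assumes u: "u \<in> Lp_sub M G p"
  shows "(\<integral>\<omega>. norm (rep u \<omega>) \<partial>M) \<le> 2 * Lp_norm M p u"
proof -
  let ?I = "\<integral>\<omega>. norm (rep u \<omega>) powr p \<partial>M"
  note int = Lp_sub_integrable_powr[OF u] and int1 = Lp_sub_integrable_norm[OF u]
  have N: "Lp_norm M p u = ?I powr (1 / p)" by (simp add: Lp_norm_def)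
  have I0: "0 \<le> ?I" by simp
  show ?thesis
  proof (cases "?I = 0")
    \<comment> \<open>The zero norm is treated apart because \<open>le_add_powr\<close> needs
      \<open>N > 0\<close>.\<close>
    case True
    then have "AE \<omega> in M. norm (rep u \<omega>) powr p = 0"
      using integral_nonneg_eq_0_iff_AE[OF int] by simp
    then have "(\<integral>\<omega>. norm (rep u \<omega>) \<partial>M) = (\<integral>\<omega>. 0 \<partial>M)"
      using int1 by (intro integral_cong_AE) auto
    then show ?thesis using N by simp
  next
    case False
    let ?N = "Lp_norm M p u"
    have Np: "?N powr p = ?I" and N0: "0 < ?N" using False I0 p N by (auto simp: powr_powr)
    have "(\<integral>\<omega>. norm (rep u \<omega>) \<partial>M) \<le> (\<integral>\<omega>. ?N + ?N powr (1 - p) * norm (rep u \<omega>) powr p \<partial>M)"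
      using int int1 N0 p by (intro integral_mono le_add_powr) auto
    also have "\<dots> = ?N + ?N powr (1 - p) * ?N powr p"
      using int by (simp add: Np prob_space)
    also have "\<dots> = 2 * ?N"
      using N0 by (simp flip: powr_add)
    finally show ?thesis .
  qed
qed

text \<open>The integrand is bounded by \<open>norm (rep u \<omega>)\<close>, so
  \<open>integral_norm_le_Lp_norm\<close> gives continuity with constant 2.\<close>

lemma integral_functional_in_Lp_dual:
  fixes f :: "'x::banach \<Rightarrow> real"
  assumes f: "linear f" "\<And>x. \<bar>f x\<bar> \<le> norm x"
    and g: "g \<in> borel_measurable M" "\<And>\<omega>. \<bar>g \<omega>\<bar> \<le> 1"
  shows "\<And>u. u \<in> Lp_sub M G p \<Longrightarrow> integrable M (\<lambda>\<omega>. g \<omega> * f (rep u \<omega>))"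
    and "(\<lambda>u. \<integral>\<omega>. g \<omega> * f (rep u \<omega>) \<partial>M) \<in> Lp_dual M G p"
proof -
  have "bounded_linear f"
    using f by (intro bounded_linear_intro[of _ 1]) (auto simp: linear_add linear_cmul)
  then have cont: "continuous_on UNIV f" by (simp add: linear_continuous_on)
  have bound: "\<bar>g \<omega> * f x\<bar> \<le> norm x" for \<omega> x
    using mult_mono[OF g(2) f(2)] by (simp add: abs_mult)
  show int: "integrable M (\<lambda>\<omega>. g \<omega> * f (rep u \<omega>))" if u: "u \<in> Lp_sub M G p" for u
    using Lp_sub_integrable_norm[OF u]
  proof (rule Bochner_Integration.integrable_bound)
    show "(\<lambda>\<omega>. g \<omega> * f (rep u \<omega>)) \<in> borel_measurable M"
      using g(1) Lp_sub_continuous_measurable[OF u cont] by simp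
  qed (simp add: bound)
  have add: "(\<integral>\<omega>. g \<omega> * f (rep (Lp_add M u v) \<omega>) \<partial>M) =
      (\<integral>\<omega>. g \<omega> * f (rep u \<omega>) \<partial>M) + (\<integral>\<omega>. g \<omega> * f (rep v \<omega>) \<partial>M)"
    if u: "u \<in> Lp_sub M G p" and v: "v \<in> Lp_sub M G p" for u v
  proof -
    \<comment> \<open>The representative of a sum is the sum of representatives only almost surely;
      measurability of its integrand is carried across this identity by completeness.\<close>
    have eq: "AE \<omega> in M. g \<omega> * f (rep u \<omega>) + g \<omega> * f (rep v \<omega>) = g \<omega> * f (rep (Lp_add M u v) \<omega>)"
      unfolding Lp_add_def using rep_ae_class[of M "\<lambda>\<omega>. rep u \<omega> + rep v \<omega>"]
      by eventually_elim (simp add: linear_add[OF f(1)] algebra_simps)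
    have "(\<lambda>\<omega>. g \<omega> * f (rep u \<omega>) + g \<omega> * f (rep v \<omega>)) \<in> borel_measurable M"
      using int[OF u] int[OF v] by simp
    with eq have "(\<integral>\<omega>. g \<omega> * f (rep (Lp_add M u v) \<omega>) \<partial>M) =
        (\<integral>\<omega>. g \<omega> * f (rep u \<omega>) + g \<omega> * f (rep v \<omega>) \<partial>M)"
      by (intro integral_cong_AE[symmetric] borel_measurable_AE_eq[OF _ eq])
    also have "\<dots> = (\<integral>\<omega>. g \<omega> * f (rep u \<omega>) \<partial>M) + (\<integral>\<omega>. g \<omega> * f (rep v \<omega>) \<partial>M)"
      using int[OF u] int[OF v] by simp
    finally show ?thesis .
  qed
  have scale: "(\<integral>\<omega>. g \<omega> * f (rep (Lp_scale M c u) \<omega>) \<partial>M) = c * (\<integral>\<omega>. g \<omega> * f (rep u \<omega>) \<partial>M)"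
    if u: "u \<in> Lp_sub M G p" for c u
  proof -
    have eq: "AE \<omega> in M. c * (g \<omega> * f (rep u \<omega>)) = g \<omega> * f (rep (Lp_scale M c u) \<omega>)"
      unfolding Lp_scale_def using rep_ae_class[of M "\<lambda>\<omega>. c *\<^sub>R rep u \<omega>"]
      by eventually_elim (simp add: linear_cmul[OF f(1)] algebra_simps)
    have "(\<lambda>\<omega>. c * (g \<omega> * f (rep u \<omega>))) \<in> borel_measurable M"
      using int[OF u] by simp
    with eq have "(\<integral>\<omega>. g \<omega> * f (rep (Lp_scale M c u) \<omega>) \<partial>M) = (\<integral>\<omega>. c * (g \<omega> * f (rep u \<omega>)) \<partial>M)"
      by (intro integral_cong_AE[symmetric] borel_measurable_AE_eq[OF _ eq])
    then show ?thesis by simp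
  qed
  have "\<bar>\<integral>\<omega>. g \<omega> * f (rep u \<omega>) \<partial>M\<bar> \<le> 2 * Lp_norm M p u" if u: "u \<in> Lp_sub M G p" for u
  proof -
    have "\<bar>\<integral>\<omega>. g \<omega> * f (rep u \<omega>) \<partial>M\<bar> \<le> (\<integral>\<omega>. \<bar>g \<omega> * f (rep u \<omega>)\<bar> \<partial>M)"
      by (rule integral_abs_bound)
    also have "\<dots> \<le> (\<integral>\<omega>. norm (rep u \<omega>) \<partial>M)"
      using int[OF u] Lp_sub_integrable_norm[OF u] bound by (intro integral_mono) auto
    also have "\<dots> \<le> 2 * Lp_norm M p u" by (rule integral_norm_le_Lp_norm[OF u])
    finally show ?thesis .
  qed
  with add scale show "(\<lambda>u. \<integral>\<omega>. g \<omega> * f (rep u \<omega>) \<partial>M) \<in> Lp_dual M G p"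
    unfolding Lp_dual_def by blast
qed

text \<open>If \<open>f \<circ> (u - v)\<close> does not vanish almost surely, then \<open>w \<mapsto> \<integral> sgn (f (u - v)) f w\<close>
  takes different values at \<open>u\<close> and \<open>v\<close>.\<close>

lemma Lp_dual_separates:
  fixes u v :: "('w, 'x::banach) rclass"
  assumes u: "u \<in> Lp_sub M G p" and v: "v \<in> Lp_sub M G p" and "u \<noteq> v"
  obtains l where "l \<in> Lp_dual M G p" "l u \<noteq> l v"
proof -
  obtain y where y: "strongly_measurable M y" "AE \<omega> in M. rep u \<omega> = y \<omega>" "u = ae_class M y"
    using Lp_sub_strongly_measurable_rep[OF u G] by metis
  obtain z where z: "strongly_measurable M z" "AE \<omega> in M. rep v \<omega> = z \<omega>" "v = ae_class M z"
    using Lp_sub_strongly_measurable_rep[OF v G] by metis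
  have "\<not> (AE \<omega> in M. y \<omega> - z \<omega> = 0)"
    using ae_class_cong[of y z M] \<open>u \<noteq> v\<close> y(3) z(3) by auto
  then obtain f :: "'x \<Rightarrow> real" where f: "linear f" "\<And>x. \<bar>f x\<bar> \<le> norm x"
      and nz: "\<not> (AE \<omega> in M. f (y \<omega> - z \<omega>) = 0)"
    using strongly_measurable_eq_0_AE[OF strongly_measurable_diff[OF y(1) z(1)]] by blast
  \<comment> \<open>Written with representatives to match the integrands of \<open>l\<close>; almost
    surely it equals \<open>f (y \<omega> - z \<omega>)\<close>.\<close>
  define d where "d \<omega> = f (rep u \<omega>) - f (rep v \<omega>)" for \<omega>
  have d: "integrable M d"
    using integral_functional_in_Lp_dual(1)[OF f, of "\<lambda>_. 1"] u v unfolding d_def by simp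
  define l where "l w = (\<integral>\<omega>. sgn (d \<omega>) * f (rep w \<omega>) \<partial>M)" for w
  have g: "(\<lambda>\<omega>. sgn (d \<omega>)) \<in> borel_measurable M" "\<bar>sgn (d \<omega>)\<bar> \<le> 1" for \<omega>
    using d by (auto simp: abs_sgn_eq)
  have "l u - l v = (\<integral>\<omega>. sgn (d \<omega>) * f (rep u \<omega>) - sgn (d \<omega>) * f (rep v \<omega>) \<partial>M)"
    unfolding l_def using integral_functional_in_Lp_dual(1)[OF f g] u v by simp
  also have "\<dots> = (\<integral>\<omega>. \<bar>d \<omega>\<bar> \<partial>M)"
    by (simp add: d_def abs_sgn algebra_simps flip: right_diff_distrib)
  also have "\<dots> \<noteq> 0"
  proof
    assume "(\<integral>\<omega>. \<bar>d \<omega>\<bar> \<partial>M) = 0"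
    then have "AE \<omega> in M. \<bar>d \<omega>\<bar> = 0"
      using integral_nonneg_eq_0_iff_AE[of M "\<lambda>\<omega>. \<bar>d \<omega>\<bar>"] d by simp
    with y(2) z(2) have "AE \<omega> in M. f (y \<omega> - z \<omega>) = 0"
      by eventually_elim (simp add: d_def linear_diff[OF f(1)])
    with nz show False ..
  qed
  finally have "l u \<noteq> l v" by simp
  moreover have "l \<in> Lp_dual M G p"
    unfolding l_def by (rule integral_functional_in_Lp_dual(2)[OF f g])
  ultimately show ?thesis by (rule that[rotated])
qed

text \<open>Each other point \<open>a\<close> has a subbasic neighbourhood that misses
  \<open>x\<close>, namely where a functional separating \<open>a\<close> from \<open>x\<close>
  avoids the value \<open>l x\<close>.\<close>

lemma openin_Lp_weak_Diff_singleton: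
  fixes x :: "('w, 'x::banach) rclass"
  assumes x: "x \<in> Lp_sub M G p"
  shows "openin (Lp_weak M G p) (Lp_sub M G p - {x})"
proof (subst openin_subopen, intro ballI)
  fix a assume a: "a \<in> Lp_sub M G p - {x}"
  then obtain l where l: "l \<in> Lp_dual M G p" "l a \<noteq> l x"
    using Lp_dual_separates[of a x] x by auto
  have "openin (Lp_weak M G p) {u \<in> Lp_sub M G p. l u \<in> - {l x}}"
    unfolding Lp_weak_def using l(1)
    by (intro topology_generated_by_Basis) (auto intro!: exI[of _ l] exI[of _ "- {l x}"])
  then show "\<exists>T. openin (Lp_weak M G p) T \<and> a \<in> T \<and> T \<subseteq> Lp_sub M G p - {x}"
    using a l(2) by (intro exI[of _ "{u \<in> Lp_sub M G p. l u \<in> - {l x}}"]) auto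
qed

end

section \<open>Complete trajectories and the attractor\<close>

lemma weakly_attracting_contains_trajectory:
  assumes sp: "complete_filtered_prob_space M F" and p: "1 < p"
    and K: "weakly_attracting M F p \<Phi> \<D> K" "\<And>t. K t \<subseteq> Lp_sub M (F t) p"
    and \<phi>: "complete_trajectory M F p \<Phi> \<phi>" "singletons \<phi> \<in> \<D>"
  shows "\<phi> t \<in> K t"
proof (rule ccontr)
  interpret complete_filtered_prob_space M F by fact
  assume "\<phi> t \<notin> K t"
  have "\<phi> t \<in> Lp_sub M (F t) p" using \<phi>(1) by (simp add: complete_trajectory_def)
  then have "openin (Lp_weak M (F t) p) (Lp_sub M (F t) p - {\<phi> t})"
    by (intro openin_Lp_weak_Diff_singleton prob_space_axioms complete_measure_axioms
        subalgebra_F p)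
  with K(2) \<open>\<phi> t \<notin> K t\<close> have "weak_neighborhood M (F t) p (K t) (Lp_sub M (F t) p - {\<phi> t})"
    unfolding weak_neighborhood_def by blast
  with K(1) \<phi>(2) have
    "\<exists>T>0. \<forall>r\<ge>T. \<Phi> r (t - r) ` singletons \<phi> (t - r) \<subseteq> Lp_sub M (F t) p - {\<phi> t}"
    unfolding weakly_attracting_def by simp
  then obtain T where T: "T > 0"
      "\<Phi> T (t - T) ` singletons \<phi> (t - T) \<subseteq> Lp_sub M (F t) p - {\<phi> t}" by blast
  \<comment> \<open>The trajectory identity is available only for \<open>s < t\<close>, hence the
    use of \<open>T > 0\<close>.\<close>
  moreover have "\<phi> t = \<Phi> T (t - T) (\<phi> (t - T))"
  proof -
    have "t - T < t \<longrightarrow> \<phi> t = \<Phi> (t - (t - T)) (t - T) (\<phi> (t - T))"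
      using \<phi>(1) unfolding complete_trajectory_def by blast
    then show ?thesis using T(1) by simp
  qed
  ultimately show False by (simp add: singletons_def)
qed

text \<open>Invariance over unit time makes \<open>\<Phi> 1\<close> map each
  \<open>A (t - n - 1)\<close> onto \<open>A (t - n)\<close>, so preimages can be picked one after
  another by dependent choice.\<close>

lemma invariant_backward_orbit:
  assumes inv: "invariant \<Phi> A" and x: "x \<in> A t"
  obtains a :: "nat \<Rightarrow> _" where "a 0 = x" "\<And>n. a n \<in> A (t - n)"
    "\<And>n. \<Phi> 1 (t - real (Suc n)) (a (Suc n)) = a n"
proof -
  \<comment> \<open>The conjunct guarded by \<open>n = 0\<close> pins the starting point to
    \<open>x\<close>.\<close>
  have "\<exists>a. \<forall>n. (a n \<in> A (t - real n) \<and> (n = 0 \<longrightarrow> a n = x)) \<and>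
      \<Phi> 1 (t - real (Suc n)) (a (Suc n)) = a n"
  proof (rule dependent_nat_choice)
    fix y n assume "y \<in> A (t - real n) \<and> (n = 0 \<longrightarrow> y = x)"
    moreover have "A (t - real n) = \<Phi> 1 (t - real n - 1) ` A (t - real n - 1)"
      using inv unfolding invariant_def by auto
    moreover have "t - real n - 1 = t - real (Suc n)" by simp
    ultimately show "\<exists>z. (z \<in> A (t - real (Suc n)) \<and> (Suc n = 0 \<longrightarrow> z = x)) \<and>
        \<Phi> 1 (t - real (Suc n)) z = y" by (auto simp del: of_nat_Suc)
  qed (use x in auto)
  then show ?thesis using that by blast
qed

lemma invariant_complete_trajectory:
  assumes rds: "mean_rds M F p \<Phi>" and inv: "invariant \<Phi> A"
    and sub: "\<And>t. A t \<subseteq> Lp_sub M (F t) p" and x: "x \<in> A t"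
  obtains \<phi> where "complete_trajectory M F p \<Phi> \<phi>" "\<And>s. \<phi> s \<in> A s" "\<phi> t = x"
proof -
  obtain a :: "nat \<Rightarrow> _" where a0: "a 0 = x" and aA: "\<And>n. a n \<in> A (t - n)"
      and aS: "\<And>n. \<Phi> 1 (t - real (Suc n)) (a (Suc n)) = a n"
    using invariant_backward_orbit[OF inv x] by metis
  have cocycle: "\<Phi> (r + s) \<tau> u = \<Phi> r (s + \<tau>) (\<Phi> s \<tau> u)"
    if "r \<ge> 0" "s \<ge> 0" "u \<in> A \<tau>" for r s \<tau> u
  proof -
    have "u \<in> Lp_sub M (F \<tau>) p" using that(3) sub by blast
    with rds that(1,2) show ?thesis unfolding mean_rds_def by simp
  qed
  \<comment> \<open>The least natural number with \<open>t - n r \<le> r\<close>; it is 0 for all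
    \<open>r \<ge> t\<close>, so the orbit then starts from \<open>x\<close> at time
    \<open>t\<close>.\<close>
  define n where "n r = nat \<lceil>t - r\<rceil>" for r
  define \<phi> where "\<phi> r = \<Phi> (r - (t - n r)) (t - n r) (a (n r))" for r
  have n: "t - n r \<le> r" for r unfolding n_def by linarith
  \<comment> \<open>Starting one grid step earlier changes nothing: by the cocycle law the extra
    unit step leads from \<open>a (Suc k)\<close> back to \<open>a k\<close>.\<close>
  have indep: "\<phi> r = \<Phi> (r - (t - k)) (t - k) (a k)" if "n r \<le> k" for r k
    using that
  proof (induction k rule: dec_induct)
    case base
    show ?case by (simp add: \<phi>_def)
  next
    case (step k)
    then have "t - k \<le> r" using n[of r] by linarith
    then have "\<Phi> (r - (t - k) + 1) (t - Suc k) (a (Suc k)) =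
        \<Phi> (r - (t - k)) (1 + (t - Suc k)) (\<Phi> 1 (t - Suc k) (a (Suc k)))"
      using aA[of "Suc k"] by (intro cocycle) auto
    moreover have "r - (t - k) + 1 = r - (t - Suc k)" "1 + (t - Suc k) = t - k" by auto
    ultimately show ?case using step.IH aS[of k] by (simp del: of_nat_Suc)
  qed
  have \<phi>A: "\<phi> r \<in> A r" for r
  proof -
    \<comment> \<open>Invariance over the duration \<open>r - (t - n r)\<close>, whose starting time
      simplifies to the grid time \<open>t - n r\<close>.\<close>
    have "A r = \<Phi> (r - (t - n r)) (r - (r - (t - n r))) ` A (r - (r - (t - n r)))"
      using inv n[of r] unfolding invariant_def by (meson diff_ge_0_iff_ge)
    then show ?thesis using aA[of "n r"] by (simp add: \<phi>_def)
  qed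
  have "\<phi> r = \<Phi> (r - s) s (\<phi> s)" if "s < r" for s r
  proof -
    \<comment> \<open>The grid point of \<open>s\<close> is no later than that of \<open>r\<close>,
      so both values can be computed from it and compared by the cocycle law.\<close>
    have "n r \<le> n s" using that unfolding n_def by (intro nat_mono ceiling_mono) auto
    then have "\<phi> r = \<Phi> (r - (t - n s)) (t - n s) (a (n s))" by (rule indep)
    also have "r - (t - n s) = (r - s) + (s - (t - n s))" by simp
    also have "\<Phi> \<dots> (t - n s) (a (n s)) =
        \<Phi> (r - s) (s - (t - n s) + (t - n s)) (\<Phi> (s - (t - n s)) (t - n s) (a (n s)))"
      using that n[of s] aA[of "n s"] by (intro cocycle) auto
    finally show ?thesis by (simp add: \<phi>_def)
  qed
  then have "complete_trajectory M F p \<Phi> \<phi>"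
    unfolding complete_trajectory_def using \<phi>A sub by blast
  moreover have "\<phi> t = x"
  proof -
    have "x \<in> Lp_sub M (F t) p" using x sub by blast
    then have "\<Phi> 0 t x = x" using rds unfolding mean_rds_def by blast
    then show ?thesis by (simp add: \<phi>_def n_def a0)
  qed
  ultimately show ?thesis using that \<phi>A by blast
qed

lemma backwards_bounded_subset:
  assumes "backwards_bounded M F p D" "\<And>t. B t \<noteq> {}" "\<And>t. B t \<subseteq> D t"
  shows "backwards_bounded M F p B"
proof -
  have mono: "Lp_bounded M p S" if "Lp_bounded M p T" "S \<subseteq> T" for S T
    using that unfolding Lp_bounded_def by blast
  obtain t0 where "Lp_bounded M p (\<Union>t\<in>{..t0}. D t)"
    using assms(1) unfolding backwards_bounded_def by blast
  then have "Lp_bounded M p (\<Union>t\<in>{..t0}. B t)"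
    by (rule mono) (use assms(3) in blast)
  moreover have "bounded_family M F p B"
    using assms mono unfolding backwards_bounded_def bounded_family_def by (meson order_trans)
  ultimately show ?thesis unfolding backwards_bounded_def by blast
qed

theorem lemma16:
  fixes M :: "'w measure" and F :: "real \<Rightarrow> 'w measure" and p :: real
    and \<Phi> :: "('w, 'x::banach) cocycle"
    and \<D> :: "('w, 'x) family set" and A :: "('w, 'x) family"
  assumes "complete_filtered_prob_space M F"
    and "1 < p"
    and "\<forall>D\<in>\<D>. bounded_family M F p D"
    and "inclusion_closed \<D>"
    and "mean_rds M F p \<Phi>"
    and "weak_attractor M F p \<Phi> \<D> A"
    and "invariant \<Phi> A"
    and "backwards_bounded M F p A"
  shows "(\<forall>t. A t = {\<phi> t |\<phi>. singletons \<phi> \<in> \<D> \<and> complete_trajectory M F p \<Phi> \<phi> \<and>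
                           backwards_bounded M F p (singletons \<phi>)}) \<and>
         ((\<forall>D. backwards_bounded M F p D \<longrightarrow> D \<in> \<D>) \<longrightarrow>
          (\<forall>t. A t = {\<phi> t |\<phi>. complete_trajectory M F p \<Phi> \<phi> \<and>
                           backwards_bounded M F p (singletons \<phi>)}))"
proof -
  have A: "A \<in> \<D>" "weakly_attracting M F p \<Phi> \<D> A"
    using assms(6) unfolding weak_attractor_def by auto
  have sub: "A t \<subseteq> Lp_sub M (F t) p" for t
    using assms(3) A(1) unfolding bounded_family_def by blast
  have le: "\<phi> t \<in> A t" if "complete_trajectory M F p \<Phi> \<phi>" "singletons \<phi> \<in> \<D>" for \<phi> t
    using weakly_attracting_contains_trajectory[OF assms(1,2) A(2) sub that] .
  have ge: "\<exists>\<phi>. x = \<phi> t \<and> singletons \<phi> \<in> \<D> \<and> complete_trajectory M F p \<Phi> \<phi> \<and>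
      backwards_bounded M F p (singletons \<phi>)" if x: "x \<in> A t" for x t
  proof -
    obtain \<phi> where \<phi>: "complete_trajectory M F p \<Phi> \<phi>" "\<And>s. \<phi> s \<in> A s" "\<phi> t = x"
      using invariant_complete_trajectory[OF assms(5,7) sub x] by metis
    have s: "singletons \<phi> s \<noteq> {}" "singletons \<phi> s \<subseteq> A s" for s
      using \<phi>(2) by (auto simp: singletons_def)
    \<comment> \<open>Inclusion-closedness is applied to the singletons inside
      \<open>A\<close>.\<close>
    have "singletons \<phi> \<in> \<D>"
      using assms(4) A(1) s unfolding inclusion_closed_def by blast
    moreover have "backwards_bounded M F p (singletons \<phi>)"
      using assms(8) s by (rule backwards_bounded_subset)
    ultimately show ?thesis using \<phi> by blast
  qed
  show ?thesis
  proof (intro conjI impI allI)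
    fix t
    show "A t = {\<phi> t |\<phi>. singletons \<phi> \<in> \<D> \<and> complete_trajectory M F p \<Phi> \<phi> \<and>
        backwards_bounded M F p (singletons \<phi>)}"
      using le ge by blast
  next
    \<comment> \<open>The added assumption puts every backwards bounded trajectory into
      \<open>\<D>\<close>, so \<open>le\<close> applies to it.\<close>
    fix t assume "\<forall>D. backwards_bounded M F p D \<longrightarrow> D \<in> \<D>"
    then show "A t = {\<phi> t |\<phi>. complete_trajectory M F p \<Phi> \<phi> \<and>
        backwards_bounded M F p (singletons \<phi>)}"
      using le ge by blast
  qed
qed

end
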